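(* Let $\gamma$ be a plane oval and $\beta$ its evolute. Then the rotation index $i$ of $\beta$ is given by $$ i=\frac{n-2}{2}, $$ where $n$ is the number of cusps of $\beta$ (or vertices of $\gamma$).
   Context: A plane oval is a simple closed smooth ($C^\infty$) strictly convex curve $\gamma$ in $\mathbb{R}^2$, with nowhere vanishing curvature $k_\gamma$. A vertex of $\gamma$ is a point where the derivative of the curvature with respect to arc-length vanishes. The evolute $\beta$ of $\gamma$ is the envelope of the normal lines of $\gamma$, i.e. the locus of centres of curvature, parametrized by the points of $\gamma$. It is a closed bounded curve consisting of an even number of smooth arcs separated by cusps, the cusps corresponding to the vertices of $\gamma$ (they are ordinary cusps if the vertices of $\gamma$ are simple), and it is locally convex: near each regular point $q$ it lies on one side of its tangent line at $q$. Standard orientation: $\beta$ is traversed so that, at every regular point, the tangent line lies locally to the left of $\beta$ (i.e. $\beta$ lies locally to the right of its tangent line, so that the signed curvature of each smooth arc is negative). Rotation index: let $\phi$ be the angle which the unit tangent vector to $\beta$ (in the standard orientation) makes with a fixed direction, measured anticlockwise. The rotation index $i$ is defined by $2\pi i=\sum_{j=1}^n(\delta\phi)_j+n\pi$, where $(\delta\phi)_j$ is the signed total change of $\phi$ along the $j$th smooth arc; that is, by convention the tangent vector rotates by $+\pi$ at each of the $n$ cusps.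
   Formalization: The oval is assumed to have finitely many vertices (for a circle n is undefined); n is the number of cusps, and it equals the number of vertices when the derivative of curvature changes sign at every vertex, since a vertex without sign change gives no cusp. *)

theory Defs
  imports "HOL-Analysis.Analysis"
begin

text \<open>
  The plane is the type \<^typ>\<open>complex\<close> with its Euclidean inner product; multiplication by
  \<^term>\<open>\<i>\<close> is the anticlockwise rotation by a right angle. A closed curve is a periodic map on
  the real line.
\<close>

definition velocity :: "(real \<Rightarrow> 'a::real_normed_vector) \<Rightarrow> real \<Rightarrow> 'a" where
  "velocity f t = vector_derivative f (at t)"

definition smooth_curve :: "(real \<Rightarrow> 'a::real_normed_vector) \<Rightarrow> bool" where
  "smooth_curve f \<longleftrightarrow> (\<forall>n t. (velocity ^^ n) f differentiable (at t))"

definition regular_at :: "(real \<Rightarrow> complex) \<Rightarrow> real \<Rightarrow> bool" where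
  "regular_at c t \<longleftrightarrow> velocity c t \<noteq> 0"

definition unit_tangent :: "(real \<Rightarrow> complex) \<Rightarrow> real \<Rightarrow> complex" where
  "unit_tangent c t = sgn (velocity c t)"

definition left_normal :: "(real \<Rightarrow> complex) \<Rightarrow> real \<Rightarrow> complex" where
  "left_normal c t = \<i> * unit_tangent c t"

definition arclength_derivative ::
    "(real \<Rightarrow> complex) \<Rightarrow> (real \<Rightarrow> 'a::real_normed_vector) \<Rightarrow> real \<Rightarrow> 'a" where
  "arclength_derivative c f t = velocity f t /\<^sub>R norm (velocity c t)"

text \<open>Signed curvature, from the Frenet equation \<open>dT/ds = k N\<close>.\<close>

definition curvature :: "(real \<Rightarrow> complex) \<Rightarrow> real \<Rightarrow> real" where
  "curvature c t = arclength_derivative c (unit_tangent c) t \<bullet> left_normal c t"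

text \<open>
  Strict convexity: apart from the point of contact, the curve lies strictly on one side of each
  of its tangent lines.
\<close>

definition strictly_convex_curve :: "(real \<Rightarrow> complex) \<Rightarrow> bool" where
  "strictly_convex_curve c \<longleftrightarrow>
     (\<forall>t. (\<forall>s. c s \<noteq> c t \<longrightarrow> (c s - c t) \<bullet> left_normal c t > 0) \<or>
          (\<forall>s. c s \<noteq> c t \<longrightarrow> (c s - c t) \<bullet> left_normal c t < 0))"

text \<open>
  No direction of traversal is prescribed, so the curvature may be positive or negative.
\<close>

definition plane_oval :: "(real \<Rightarrow> complex) \<Rightarrow> real \<Rightarrow> bool" where
  "plane_oval \<gamma> p \<longleftrightarrow>
     0 < p \<and> (\<forall>t. \<gamma> (t + p) = \<gamma> t) \<and> inj_on \<gamma> {0..<p} \<and>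
     smooth_curve \<gamma> \<and> (\<forall>t. regular_at \<gamma> t) \<and>
     strictly_convex_curve \<gamma> \<and> (\<forall>t. curvature \<gamma> t \<noteq> 0)"

definition vertex_at :: "(real \<Rightarrow> complex) \<Rightarrow> real \<Rightarrow> bool" where
  "vertex_at \<gamma> t \<longleftrightarrow> arclength_derivative \<gamma> (curvature \<gamma>) t = 0"

definition vertices :: "(real \<Rightarrow> complex) \<Rightarrow> complex set" where
  "vertices \<gamma> = {\<gamma> t |t. vertex_at \<gamma> t}"

definition changes_sign_at :: "(real \<Rightarrow> real) \<Rightarrow> real \<Rightarrow> bool" where
  "changes_sign_at f t \<longleftrightarrow>
     (\<forall>\<^sub>F s in at_left t. f s < 0) \<and> (\<forall>\<^sub>F s in at_right t. 0 < f s) \<or>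
     (\<forall>\<^sub>F s in at_left t. 0 < f s) \<and> (\<forall>\<^sub>F s in at_right t. f s < 0)"

text \<open>The locus of centres of curvature; it does not depend on the direction of \<open>\<gamma>\<close>.\<close>

definition evolute :: "(real \<Rightarrow> complex) \<Rightarrow> real \<Rightarrow> complex" where
  "evolute \<gamma> t = \<gamma> t + left_normal \<gamma> t /\<^sub>R curvature \<gamma> t"

text \<open>Near each regular point the curve lies to the right of its directed tangent line there.\<close>

definition standardly_oriented :: "(real \<Rightarrow> complex) \<Rightarrow> bool" where
  "standardly_oriented c \<longleftrightarrow>
     (\<forall>t. regular_at c t \<longrightarrow> (\<forall>\<^sub>F s in at t. (c s - c t) \<bullet> left_normal c t < 0))"

definition standard_evolute :: "(real \<Rightarrow> complex) \<Rightarrow> (real \<Rightarrow> complex) \<Rightarrow> bool" where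
  "standard_evolute \<gamma> \<beta> \<longleftrightarrow>
     (\<beta> = evolute \<gamma> \<or> \<beta> = (\<lambda>t. evolute \<gamma> (- t))) \<and> standardly_oriented \<beta>"

text \<open>
  A cusp is a singular point at which the unit tangent vector jumps to its opposite.
\<close>

definition cusp_at :: "(real \<Rightarrow> complex) \<Rightarrow> real \<Rightarrow> bool" where
  "cusp_at c t \<longleftrightarrow> \<not> regular_at c t \<and>
     (\<exists>u. norm u = 1 \<and> (unit_tangent c \<longlongrightarrow> u) (at_left t) \<and>
          (unit_tangent c \<longlongrightarrow> - u) (at_right t))"

text \<open>
  Cusps of a closed curve of period \<open>p\<close> are counted by parameter, once per period: distinct cusps
  of an evolute may coincide as points of the plane.
\<close>

definition cusps :: "(real \<Rightarrow> complex) \<Rightarrow> real \<Rightarrow> real set" where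
  "cusps c p = {t \<in> {0..<p}. cusp_at c t}"

definition next_cusp :: "(real \<Rightarrow> complex) \<Rightarrow> real \<Rightarrow> real" where
  "next_cusp c t = Inf {s. t < s \<and> cusp_at c s}"

text \<open>
  The total change, along the arc with parameters between \<open>a\<close> and \<open>b\<close>, of a continuous angle
  \<open>\<phi>\<close> of the tangent vector. Its values at \<open>a\<close> and \<open>b\<close> are one-sided limits. At isolated singular
  points inside the arc the equation is void and \<open>\<phi>\<close> is fixed by continuity.
\<close>

definition angle_change :: "(real \<Rightarrow> complex) \<Rightarrow> real \<Rightarrow> real \<Rightarrow> real" where
  "angle_change c a b =
     (THE d. \<exists>\<phi>. continuous_on {a..b} \<phi> \<and>
        (\<forall>t\<in>{a<..<b}. velocity c t = of_real (norm (velocity c t)) * cis (\<phi> t)) \<and>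
        d = \<phi> b - \<phi> a)"

text \<open>
  Each cusp in a period begins one smooth arc, which ends at the next cusp (the last arc runs into
  the next period). Meaningful for curves with at least one and finitely many cusps per period.
\<close>

definition rotation_index :: "(real \<Rightarrow> complex) \<Rightarrow> real \<Rightarrow> real" where
  "rotation_index c p =
     ((\<Sum>t\<in>cusps c p. angle_change c t (next_cusp c t)) + real (card (cusps c p)) * pi) / (2 * pi)"

end

theory Submission
  imports Defs
begin

text \<open>
  Write the unit tangent of the oval as \<open>cis \<theta>\<close>, with \<open>\<theta>\<close> strictly monotone because the curvature \<open>k\<close> never
  vanishes; strict convexity forces \<open>\<theta>\<close> to change by exactly \<open>\<plusminus>2\<pi>\<close> over a period. The evolute has
  velocity \<open>w \<i> cis \<theta>\<close> with \<open>w = - k' / k\<^sup>2\<close>, so its cusps are the sign changes of \<open>w\<close>, and between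
  consecutive cusps its tangent angle differs from \<open>\<theta>\<close> by a constant. The standard orientation means
  that this angle decreases, so the angle changes of the smooth arcs telescope to \<open>- 2\<pi>\<close>. There is at
  least one cusp because \<open>w\<close> is the derivative of the periodic function \<open>1 / k\<close>.
\<close>

subsection \<open>Kinematics of plane curves\<close>

lemma cis_inner_i_cis: "cis a \<bullet> (\<i> * cis b) = sin (a - b)"
  by (simp add: inner_complex_def sin_diff cis.simps)

lemma cis_eq_1_iff: "cis x = 1 \<longleftrightarrow> (\<exists>n::int. x = 2 * pi * of_int n)"
proof
  assume "cis x = 1"
  then have "cos x = 1" by (metis cis.simps(1) one_complex.simps(1))
  then show "\<exists>n::int. x = 2 * pi * of_int n"
    by (auto simp: cos_one_2pi_int algebra_simps)
qed auto

lemma complex_eq_orthonormal_expansion: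
  assumes "norm z = 1"
  shows "x = (x \<bullet> z) *\<^sub>R z + (x \<bullet> (\<i> * z)) *\<^sub>R (\<i> * z)"
proof -
  have "(Re z)\<^sup>2 + (Im z)\<^sup>2 = 1"
    using assms by (simp add: norm_complex_def)
  then have "Re x = (Re x * Re z + Im x * Im z) * Re z + (Im x * Re z - Re x * Im z) * (- Im z)"
    and "Im x = (Re x * Re z + Im x * Im z) * Im z + (Im x * Re z - Re x * Im z) * Re z"
    by algebra+
  then show ?thesis
    by (simp add: complex_eq_iff inner_complex_def)
qed

lemma smooth_curve_has_vector_derivative:
  assumes "smooth_curve f"
  shows "((velocity ^^ n) f has_vector_derivative (velocity ^^ Suc n) f t) (at t)"
  using assms vector_derivative_works
  by (auto simp: smooth_curve_def velocity_def)

lemma DERIV_norm_vector: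
  fixes v :: "real \<Rightarrow> 'a::real_inner"
  assumes "(v has_vector_derivative v') (at t)" "v t \<noteq> 0"
  shows "((\<lambda>s. norm (v s)) has_real_derivative (v' \<bullet> sgn (v t))) (at t)"
  unfolding has_field_derivative_def
  by (rule has_derivative_eq_rhs[OF has_derivative_compose[OF
        assms(1)[unfolded has_vector_derivative_def] has_derivative_norm[OF assms(2)]]])
     (simp add: fun_eq_iff inner_commute)

text \<open>The derivative of a unit vector is orthogonal to it, so \<open>T'\<close> is a multiple
  of \<open>\<i> * T\<close>, with the coefficient read off from the definition of curvature. The
  second formula eliminates \<open>T'\<close> in favour of two derivatives of \<open>c\<close>, so
  that the curvature itself can be differentiated.\<close>

lemma curvature_formula:
  assumes "(v has_vector_derivative v') (at t)" "v = velocity c" "v t \<noteq> 0"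
  shows "(unit_tangent c has_vector_derivative
            (curvature c t * norm (v t)) *\<^sub>R (\<i> * unit_tangent c t)) (at t)"
    and "curvature c t = (v' \<bullet> (\<i> * v t)) / norm (v t) ^ 3"
proof -
  define T where "T = unit_tangent c"
  have T: "T = (\<lambda>s. inverse (norm (v s)) *\<^sub>R v s)"
    by (simp add: T_def unit_tangent_def assms(2) sgn_div_norm fun_eq_iff)
  have nT: "norm (T t) = 1" using assms by (simp add: T_def unit_tangent_def norm_sgn)
  have dn: "((\<lambda>s. norm (v s)) has_real_derivative (v' \<bullet> sgn (v t))) (at t)"
    by (rule DERIV_norm_vector[OF assms(1,3)])
  \<comment> \<open>\<open>?r\<close> is the derivative of \<open>1 / norm v\<close>.\<close>
  let ?r = "- (inverse (norm (v t)) * (v' \<bullet> sgn (v t)) * inverse (norm (v t)))"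
  have dT: "(T has_vector_derivative (inverse (norm (v t)) *\<^sub>R v' + ?r *\<^sub>R v t)) (at t)"
    unfolding T
    by (rule has_vector_derivative_scaleR[OF DERIV_inverse'[OF dn] assms(1)]) (use assms(3) in simp)
  then have vT: "velocity T t = inverse (norm (v t)) *\<^sub>R v' + ?r *\<^sub>R v t"
    unfolding velocity_def by (rule vector_derivative_at)
  have orth: "v t \<bullet> (\<i> * v t) = 0" by (simp add: inner_complex_def)
  have vs: "norm (v t) *\<^sub>R sgn (v t) = v t" using assms(3) by (simp add: sgn_div_norm)
  have "velocity T t \<bullet> T t = 0"
    unfolding vT using assms(3)
    by (simp add: T inner_add_left inner_diff_left sgn_div_norm dot_square_norm power2_eq_square field_simps)
  then have "velocity T t = (velocity T t \<bullet> (\<i> * T t)) *\<^sub>R (\<i> * T t)"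
    using complex_eq_orthonormal_expansion[OF nT, of "velocity T t"] by simp
  moreover have "velocity T t \<bullet> (\<i> * T t) = curvature c t * norm (v t)"
    using assms by (simp add: curvature_def arclength_derivative_def left_normal_def T_def)
  ultimately have vT': "velocity T t = (curvature c t * norm (v t)) *\<^sub>R (\<i> * T t)"
    by simp
  show "(unit_tangent c has_vector_derivative
            (curvature c t * norm (v t)) *\<^sub>R (\<i> * unit_tangent c t)) (at t)"
    using dT vT vT' by (simp add: T_def)
  have "curvature c t = (velocity T t \<bullet> (\<i> * T t)) / norm (v t)"
    using assms by (simp add: curvature_def arclength_derivative_def left_normal_def T_def divide_inverse)
  also have "\<dots> = (v' \<bullet> (\<i> * v t)) / norm (v t) ^ 3"
    unfolding vT using assms(3) orth
    by (simp add: T inner_add_left inner_diff_left divide_simps power3_eq_cube)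
  finally show "curvature c t = (v' \<bullet> (\<i> * v t)) / norm (v t) ^ 3" .
qed

text \<open>By \<open>curvature_formula\<close> the curvature is a quotient in the first two
  derivatives of \<open>c\<close>, with nonzero denominator by regularity. Its derivative involves
  three of them and is therefore continuous.\<close>

lemma curvature_continuously_differentiable:
  assumes "smooth_curve c" "\<And>t. regular_at c t"
  shows "(curvature c has_real_derivative velocity (curvature c) t) (at t)"
    and "continuous_on UNIV (velocity (curvature c))"
proof -
  let ?v = "velocity c" let ?a = "(velocity ^^ 2) c" let ?b = "(velocity ^^ 3) c"
  have dv: "(?v has_vector_derivative ?a t) (at t)" for t
    using smooth_curve_has_vector_derivative[OF assms(1), of 1] by (simp add: numeral_2_eq_2)
  have da: "(?a has_vector_derivative ?b t) (at t)" for t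
    using smooth_curve_has_vector_derivative[OF assms(1), of 2]
    by (simp add: numeral_2_eq_2 numeral_3_eq_3)
  \<comment> \<open>The fourth derivative serves to make the third one continuous.\<close>
  have db: "(?b has_vector_derivative (velocity ^^ 4) c t) (at t)" for t
    using smooth_curve_has_vector_derivative[OF assms(1), of 3]
    by (simp add: eval_nat_numeral)
  have nz: "?v t \<noteq> 0" for t using assms(2) by (simp add: regular_at_def)
  have k: "curvature c = (\<lambda>t. (?a t \<bullet> (\<i> * ?v t)) / norm (?v t) ^ 3)"
    using curvature_formula(2)[OF dv refl nz] by blast
  have cont: "continuous_on UNIV ?v" "continuous_on UNIV ?a" "continuous_on UNIV ?b"
    using dv da db by (meson continuous_at_imp_continuous_on has_vector_derivative_continuous)+
  have dn: "((\<lambda>s. norm (?v s)) has_real_derivative (?a t \<bullet> sgn (?v t))) (at t)" for t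
    by (rule DERIV_norm_vector[OF dv nz])
  have dq: "((\<lambda>s. ?a s \<bullet> (\<i> * ?v s)) has_real_derivative
      ?a t \<bullet> (\<i> * ?a t) + ?b t \<bullet> (\<i> * ?v t)) (at t)" for t
    unfolding has_field_derivative_def
    by (rule has_derivative_eq_rhs[OF has_derivative_inner[OF da[unfolded has_vector_derivative_def]
        has_derivative_mult_right[OF dv[unfolded has_vector_derivative_def], of \<i>]]])
       (simp add: fun_eq_iff algebra_simps)
  define g where "g t = ((?a t \<bullet> (\<i> * ?a t) + ?b t \<bullet> (\<i> * ?v t)) * norm (?v t) ^ 3
      - (?a t \<bullet> (\<i> * ?v t)) * (3 * norm (?v t) ^ 2 * (?a t \<bullet> sgn (?v t))))
      / (norm (?v t) ^ 3 * norm (?v t) ^ 3)" for t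
  have dk: "(curvature c has_real_derivative g t) (at t)" for t
    unfolding k g_def
    by (rule derivative_eq_intros dq dn refl)+ (use nz in \<open>simp_all add: mult_ac\<close>)
  then have vk: "velocity (curvature c) = g"
    by (auto simp: fun_eq_iff velocity_def has_real_derivative_iff_has_vector_derivative
        intro!: vector_derivative_at)
  show "(curvature c has_real_derivative velocity (curvature c) t) (at t)"
    using dk vk by simp
  have "continuous_on UNIV g"
    unfolding g_def[abs_def] sgn_div_norm
    by (intro continuous_intros cont) (use nz in auto)
  then show "continuous_on UNIV (velocity (curvature c))"
    using vk by simp
qed

text \<open>By the Frenet equation \<open>\<i> * T' / k\<close> is the negative of the velocity of
  \<open>c\<close> and cancels it. What survives is the derivative of the signed radius
  \<open>1 / k\<close>, directed along the normal.\<close>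

lemma evolute_has_vector_derivative:
  assumes "smooth_curve c" "\<And>t. regular_at c t" "curvature c t \<noteq> 0"
  shows "(evolute c has_vector_derivative
    (- velocity (curvature c) t / (curvature c t)\<^sup>2) *\<^sub>R left_normal c t) (at t)"
proof -
  let ?v = "velocity c" let ?T = "unit_tangent c" let ?k = "curvature c"
  have dc: "(c has_vector_derivative ?v t) (at t)"
    using smooth_curve_has_vector_derivative[OF assms(1), of 0] by simp
  have dv: "(?v has_vector_derivative (velocity ^^ 2) c t) (at t)"
    using smooth_curve_has_vector_derivative[OF assms(1), of 1] by (simp add: numeral_2_eq_2)
  have nz: "?v t \<noteq> 0" using assms(2) by (simp add: regular_at_def)
  have dT: "(?T has_vector_derivative (?k t * norm (?v t)) *\<^sub>R (\<i> * ?T t)) (at t)"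
    by (rule curvature_formula(1)[OF dv refl nz])
  have vT: "?v t = norm (?v t) *\<^sub>R ?T t" using nz by (simp add: unit_tangent_def sgn_div_norm)
  have dk: "((\<lambda>t. inverse (?k t)) has_real_derivative
      - (inverse (?k t) * velocity ?k t * inverse (?k t))) (at t)"
    by (rule DERIV_inverse'[OF curvature_continuously_differentiable(1)[OF assms(1,2)] assms(3)])
  have "((\<lambda>s. c s + inverse (?k s) *\<^sub>R (\<i> * ?T s)) has_vector_derivative
     ?v t + (inverse (?k t) *\<^sub>R (\<i> * ((?k t * norm (?v t)) *\<^sub>R (\<i> * ?T t)))
     + - (inverse (?k t) * velocity ?k t * inverse (?k t)) *\<^sub>R (\<i> * ?T t))) (at t)"
    by (intro has_vector_derivative_add dc has_vector_derivative_scaleR dk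
        has_vector_derivative_mult_right dT)
  moreover have "?v t + (inverse (?k t) *\<^sub>R (\<i> * ((?k t * norm (?v t)) *\<^sub>R (\<i> * ?T t)))
     + - (inverse (?k t) * velocity ?k t * inverse (?k t)) *\<^sub>R (\<i> * ?T t))
     = (- velocity ?k t / (?k t)\<^sup>2) *\<^sub>R left_normal c t"
  proof -
    have "inverse (?k t) *\<^sub>R (\<i> * ((?k t * norm (?v t)) *\<^sub>R (\<i> * ?T t))) = - ?v t"
      using assms(3) by (subst (2) vT) (simp add: field_simps)
    then show ?thesis by (simp add: left_normal_def power2_eq_square field_simps)
  qed
  ultimately show ?thesis by (simp add: evolute_def[abs_def] left_normal_def[abs_def])
qed

text \<open>An antiderivative \<open>F\<close> of \<open>k * norm v\<close> turns at the same rate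
  as the tangent, so \<open>T * cis (- F)\<close> is constant, and the argument of this constant is
  the missing constant of integration.\<close>

lemma regular_curve_has_angle_function:
  assumes "smooth_curve c" "\<And>t. regular_at c t"
  obtains \<theta> where "\<And>t. unit_tangent c t = cis (\<theta> t)"
    and "\<And>t. (\<theta> has_real_derivative curvature c t * norm (velocity c t)) (at t)"
proof -
  let ?v = "velocity c" let ?T = "unit_tangent c" let ?k = "curvature c"
  have dv: "(?v has_vector_derivative (velocity ^^ 2) c t) (at t)" for t
    using smooth_curve_has_vector_derivative[OF assms(1), of 1] by (simp add: numeral_2_eq_2)
  have nz: "?v t \<noteq> 0" for t using assms(2) by (simp add: regular_at_def)
  have dT: "(?T has_vector_derivative (?k t * norm (?v t)) *\<^sub>R (\<i> * ?T t)) (at t)" for t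
    by (rule curvature_formula(1)[OF dv refl nz])
  have "isCont (\<lambda>t. ?k t * norm (?v t)) t" for t
    using DERIV_isCont[OF curvature_continuously_differentiable(1)[OF assms]]
      has_vector_derivative_continuous[OF dv]
    by (intro continuous_intros) auto
  \<comment> \<open>Infinite endpoints give an antiderivative on the whole line at once, on both
    sides of 0.\<close>
  then obtain F where F: "(F has_vector_derivative ?k t * norm (?v t)) (at t)" for t
    using einterval_antiderivative[of "-\<infinity>" "\<infinity>" "\<lambda>t. ?k t * norm (?v t)"] by auto
  have "((\<lambda>t. ?T t * cis (- F t)) has_derivative (\<lambda>h. 0)) (at t)" for t
  proof -
    have "((\<lambda>t. ?T t * cis (- F t)) has_derivative
      (\<lambda>h. ?T t * ((- (h *\<^sub>R (?k t * norm (?v t)))) *\<^sub>R (\<i> * cis (- F t)))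
         + (h *\<^sub>R ((?k t * norm (?v t)) *\<^sub>R (\<i> * ?T t))) * cis (- F t))) (at t)"
      using dT[of t] F[of t] unfolding has_vector_derivative_def
      by (intro has_derivative_mult has_derivative_cis has_derivative_minus) auto
    then show ?thesis by (simp add: algebra_simps)
  qed
  then have const: "?T t * cis (- F t) = ?T 0 * cis (- F 0)" for t
    using has_derivative_zero_unique[of UNIV "\<lambda>t. ?T t * cis (- F t)" t 0] by simp
  have "norm (?T 0 * cis (- F 0)) = 1"
    using nz by (simp add: unit_tangent_def norm_sgn norm_mult)
  then obtain a where a: "?T 0 * cis (- F 0) = cis a"
    by (metis complex_norm_eq_1_exp cis_conv_exp)
  have "?T t = cis (F t + a)" for t
  proof -
    have "?T t = (?T t * cis (- F t)) * cis (F t)" by (simp add: mult.assoc cis_mult)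
    then show ?thesis using const[of t] a by (simp add: cis_mult add.commute)
  qed
  moreover have "((\<lambda>t. F t + a) has_real_derivative ?k t * norm (?v t)) (at t)" for t
    using F[of t] by (auto simp: has_real_derivative_iff_has_vector_derivative
        intro!: derivative_eq_intros)
  ultimately show ?thesis using that[of "\<lambda>t. F t + a"] by blast
qed

text \<open>The height over the tangent line at \<open>t\<close>, multiplied by \<open>e\<close>,
  has derivative \<open>\<sigma> * W s\<close> times \<open>e * sin (\<Psi> s - \<Psi> t)\<close>,
  and both factors are positive just after \<open>t\<close>. This serves for the oval, where
  \<open>W\<close> is the speed, and for the evolute, where \<open>W\<close> may be
  negative.\<close>

lemma tangent_line_side:
  assumes deriv: "\<And>s. (c has_vector_derivative of_real (W s) * cis (\<Psi> s)) (at s)"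
    and "isCont W t" "isCont \<Psi> t" "W t \<noteq> 0"
    and e: "e = 1 \<or> e = -1" and mono: "strict_mono (\<lambda>s. e * \<Psi> s)"
  shows "\<forall>\<^sub>F s in at_right t. e * ((c s - c t) \<bullet> left_normal c t) > 0"
proof -
  define \<sigma> where "\<sigma> = sgn (W t)"
  have vel: "velocity c t = of_real (W t) * cis (\<Psi> t)"
    unfolding velocity_def by (rule vector_derivative_at[OF deriv])
  have N: "left_normal c t = \<sigma> *\<^sub>R (\<i> * cis (\<Psi> t))"
    by (simp add: left_normal_def unit_tangent_def vel \<sigma>_def sgn_mult sgn_of_real
        scaleR_conv_of_real)
  define g where "g s = e * ((c s - c t) \<bullet> (\<sigma> *\<^sub>R (\<i> * cis (\<Psi> t))))" for s
  have dg: "(g has_real_derivative (\<sigma> * W s) * (e * sin (\<Psi> s - \<Psi> t))) (at s)" for s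
  proof -
    have "((\<lambda>s. (c s - c t) \<bullet> (\<sigma> *\<^sub>R (\<i> * cis (\<Psi> t)))) has_derivative
      (\<lambda>h. (h *\<^sub>R (of_real (W s) * cis (\<Psi> s)) - 0) \<bullet> (\<sigma> *\<^sub>R (\<i> * cis (\<Psi> t))))) (at s)"
      by (intro has_derivative_inner_left has_derivative_diff has_derivative_const
          deriv[unfolded has_vector_derivative_def])
    then have "((\<lambda>s. (c s - c t) \<bullet> (\<sigma> *\<^sub>R (\<i> * cis (\<Psi> t)))) has_real_derivative
        \<sigma> * W s * sin (\<Psi> s - \<Psi> t)) (at s)"
      unfolding has_field_derivative_def
      by (rule has_derivative_eq_rhs)
         (simp add: fun_eq_iff cis_inner_i_cis flip: scaleR_conv_of_real)
    from DERIV_cmult[OF this, of e] show ?thesis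
      by (simp add: g_def[abs_def] mult_ac)
  qed
  have "\<forall>\<^sub>F s in at_right t. \<sigma> * W s > 0"
  proof (rule order_tendstoD)
    show "((\<lambda>s. \<sigma> * W s) \<longlongrightarrow> \<sigma> * W t) (at_right t)"
      using assms(2) by (intro tendsto_intros) (simp add: isCont_def filterlim_at_split)
    show "0 < \<sigma> * W t" using assms(4) by (simp add: \<sigma>_def sgn_if)
  qed
  \<comment> \<open>Within distance \<open>pi\<close> the sine has the sign of the angle
    difference.\<close>
  moreover have "\<forall>\<^sub>F s in at_right t. dist (\<Psi> s) (\<Psi> t) < pi"
    using assms(3) by (intro tendstoD) (simp_all add: isCont_def filterlim_at_split)
  ultimately have "\<forall>\<^sub>F s in at_right t. \<sigma> * W s > 0 \<and> dist (\<Psi> s) (\<Psi> t) < pi"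
    by eventually_elim simp
  then obtain b where b: "b > t" "\<And>s. t < s \<Longrightarrow> s < b \<Longrightarrow> \<sigma> * W s > 0 \<and> dist (\<Psi> s) (\<Psi> t) < pi"
    unfolding eventually_at_right[OF less_add_one] by blast
  have "0 < g s" if s: "t < s" "s < b" for s
  proof -
    have "g t < g s"
    proof (rule DERIV_pos_imp_increasing_open[OF s(1)])
      fix x assume x: "t < x" "x < s"
      have 1: "0 < e * (\<Psi> x - \<Psi> t)"
        using strict_monoD[OF mono x(1)] by (simp add: algebra_simps)
      moreover have "e * (\<Psi> x - \<Psi> t) < pi"
        using b(2)[of x] x s e by (auto simp: dist_real_def)
      ultimately have "0 < sin (e * (\<Psi> x - \<Psi> t))" by (rule sin_gt_zero)
      also have "\<dots> = e * sin (\<Psi> x - \<Psi> t)"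
        using e sin_minus[of "\<Psi> x - \<Psi> t"] by auto
      finally have "0 < (\<sigma> * W x) * (e * sin (\<Psi> x - \<Psi> t))"
        using b(2)[of x] x s by (intro mult_pos_pos[of "\<sigma> * W x"]) auto
      then show "\<exists>y. (g has_real_derivative y) (at x) \<and> 0 < y" using dg by blast
    qed (meson DERIV_isCont dg continuous_at_imp_continuous_on)
    then show ?thesis by (simp add: g_def)
  qed
  then show ?thesis
    unfolding eventually_at_right[OF less_add_one] N g_def using b(1) by blast
qed

subsection \<open>Periodic sets and sign changes\<close>

text \<open>The sum telescopes: passing to the next element permutes the elements of a period
  cyclically, except that the largest one moves on to the smallest one shifted by \<open>p\<close>,
  which contributes \<open>d\<close>. A single element per period is included, its successor being
  its own shift.\<close>

lemma sum_next_periodic: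
  fixes C :: "real set" and F :: "real \<Rightarrow> real" and p :: real
  assumes p: "0 < p" and per: "\<And>t. t + p \<in> C \<longleftrightarrow> t \<in> C"
    and fin: "finite {t \<in> {0..<p}. t \<in> C}" and ne: "{t \<in> {0..<p}. t \<in> C} \<noteq> {}"
    and F: "\<And>t. F (t + p) = F t + d"
  defines "nxt \<equiv> \<lambda>t. Inf {s. t < s \<and> s \<in> C}"
  shows "\<And>t. t \<in> {0..<p} \<Longrightarrow> t \<in> C \<Longrightarrow> t < nxt t \<and> nxt t \<in> C \<and> (\<forall>s\<in>C. t < s \<longrightarrow> nxt t \<le> s)"
    and "(\<Sum>t | t \<in> {0..<p} \<and> t \<in> C. F (nxt t) - F t) = d"
proof -
  define C0 where "C0 = {t \<in> {0..<p}. t \<in> C}"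
  have nxt: "t < nxt t \<and> nxt t \<in> C \<and> (\<forall>s\<in>C. t < s \<longrightarrow> nxt t \<le> s)" if t: "t \<in> C0" for t
  proof -
    \<comment> \<open>One full period after \<open>t\<close> contains at least the point
      \<open>t + p\<close> and only finitely many points of \<open>C\<close>, so the infimum is
      attained as \<open>Min K\<close>.\<close>
    define K where "K = {s \<in> C. t < s \<and> s \<le> t + p}"
    have "K \<subseteq> C0 \<union> (\<lambda>s. s + p) ` C0"
    proof
      fix s assume s: "s \<in> K"
      have "s - p \<in> C" using s per[of "s - p"] by (simp add: K_def)
      then have "s \<in> C0 \<or> s - p \<in> C0" using s t by (auto simp: C0_def K_def)
      then show "s \<in> C0 \<union> (\<lambda>s. s + p) ` C0"
        by (metis UnI1 UnI2 diff_add_cancel image_eqI)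
    qed
    then have finK: "finite K" using fin unfolding C0_def by (meson finite_UnI finite_imageI finite_subset)
    have tpK: "t + p \<in> K" using t p per[of t] by (simp add: K_def C0_def)
    have MK: "Min K \<in> K" using finK tpK by (intro Min_in) auto
    have le: "Min K \<le> s" if "s \<in> C" "t < s" for s
    proof (cases "s \<le> t + p")
      case True
      then show ?thesis using that finK by (intro Min_le) (auto simp: K_def)
    next
      case False
      then show ?thesis using Min_le[OF finK tpK] by simp
    qed
    have "nxt t = Min K"
      unfolding nxt_def by (rule cInf_eq_minimum) (use MK le in \<open>auto simp: K_def\<close>)
    then show ?thesis using MK le by (auto simp: K_def)
  qed
  then show "\<And>t. t \<in> {0..<p} \<Longrightarrow> t \<in> C \<Longrightarrow> t < nxt t \<and> nxt t \<in> C \<and> (\<forall>s\<in>C. t < s \<longrightarrow> nxt t \<le> s)"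
    by (simp add: C0_def)
  have fin0: "finite C0" and ne0: "C0 \<noteq> {}" using fin ne by (auto simp: C0_def)
  define m where "m = Min C0"
  define M where "M = Max C0"
  have m: "m \<in> C0" "\<And>s. s \<in> C0 \<Longrightarrow> m \<le> s" and M: "M \<in> C0" "\<And>s. s \<in> C0 \<Longrightarrow> s \<le> M"
    using fin0 ne0 by (auto simp: m_def M_def)
  \<comment> \<open>The successor of the last point lies in the next period. Shifted back by
    \<open>p\<close> it belongs to \<open>C0\<close>, so it cannot come before
    \<open>m + p\<close>.\<close>
  have nxtM: "nxt M = m + p"
  proof (rule antisym)
    have "m + p \<in> C" "M < m + p" using m(1) M(1) per by (auto simp: C0_def)
    then show le: "nxt M \<le> m + p" using nxt[OF M(1)] by blast
    have "nxt M \<notin> C0" using nxt[OF M(1)] M(2) by force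
    then have "p \<le> nxt M" using nxt[OF M(1)] M(1) by (auto simp: C0_def)
    moreover have "nxt M - p \<in> C" using nxt[OF M(1)] per[of "nxt M - p"] by simp
    ultimately have "nxt M - p \<in> C0" using le m(1) by (auto simp: C0_def)
    then show "m + p \<le> nxt M" using m(2)[of "nxt M - p"] by simp
  qed
  have maps: "nxt ` (C0 - {M}) \<subseteq> C0 - {m}"
  proof
    fix x assume "x \<in> nxt ` (C0 - {M})"
    then obtain t where t: "t \<in> C0" "t \<noteq> M" "x = nxt t" by auto
    have "t < M" using M(2)[OF t(1)] t(2) by simp
    then have "x \<le> M" using nxt[OF t(1)] M(1) t(3) by (auto simp: C0_def)
    then have "x \<in> C0" using nxt[OF t(1)] t M(1) by (auto simp: C0_def)
    moreover have "m < x" using nxt[OF t(1)] m(2)[OF t(1)] t(3) by simp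
    ultimately show "x \<in> C0 - {m}" by simp
  qed
  have inj: "inj_on nxt (C0 - {M})"
  proof (rule inj_onI)
    fix x y assume xy: "x \<in> C0 - {M}" "y \<in> C0 - {M}" "nxt x = nxt y"
    have "nxt x \<le> y" if "x < y" using nxt[of x] xy that by (auto simp: C0_def)
    moreover have "nxt y \<le> x" if "y < x" using nxt[of y] xy that by (auto simp: C0_def)
    moreover have "x < nxt x" "y < nxt y" using nxt[of x] nxt[of y] xy by simp_all
    ultimately show "x = y" using xy(3) by linarith
  qed
  \<comment> \<open>Surjectivity follows from injectivity because the two finite sets have equally
    many elements.\<close>
  have "nxt ` (C0 - {M}) = C0 - {m}"
    using fin0 m(1) M(1) by (intro card_subset_eq maps) (auto simp: card_image[OF inj])
  then have bij: "bij_betw nxt (C0 - {M}) (C0 - {m})"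
    using inj by (simp add: bij_betw_def)
  have "(\<Sum>t\<in>C0. F (nxt t)) = F (nxt M) + (\<Sum>t\<in>C0 - {M}. F (nxt t))"
    by (rule sum.remove[OF fin0 M(1)])
  also have "\<dots> = d + (F m + (\<Sum>t\<in>C0 - {m}. F t))"
    using sum.reindex_bij_betw[OF bij, of F] by (simp add: nxtM F)
  also have "F m + (\<Sum>t\<in>C0 - {m}. F t) = (\<Sum>t\<in>C0. F t)"
    by (rule sum.remove[OF fin0 m(1), symmetric])
  finally have "(\<Sum>t\<in>C0. F (nxt t) - F t) = d" by (simp add: sum_subtractf)
  then show "(\<Sum>t | t \<in> {0..<p} \<and> t \<in> C. F (nxt t) - F t) = d"
    by (simp add: C0_def)
qed

lemma periodic_int_shift:
  fixes f :: "real \<Rightarrow> 'a"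
  assumes "\<And>t. f (t + p) = f t"
  shows "f (t + of_int n * p) = f t"
proof (induction n rule: int_induct[where k = 0])
  case (step1 i)
  then show ?case using assms[of "t + of_int i * p"] by (simp add: algebra_simps)
next
  case (step2 i)
  then show ?case using assms[of "t + of_int (i - 1) * p"] by (simp add: algebra_simps)
qed simp

lemma period_representative:
  fixes t p :: real
  assumes "0 < p"
  obtains n :: int where "t + of_int n * p \<in> {0..<p}"
proof
  have "of_int \<lfloor>t / p\<rfloor> * p \<le> t"
    by (rule floor_divide_lower[OF assms])
  moreover have "t < (of_int \<lfloor>t / p\<rfloor> + 1) * p"
    by (rule floor_divide_upper[OF assms])
  ultimately show "t + of_int (- \<lfloor>t / p\<rfloor>) * p \<in> {0..<p}" by (simp add: algebra_simps)
qed

lemma continuous_sign_constant: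
  fixes W :: "real \<Rightarrow> real"
  assumes "continuous_on {a<..<b} W" "\<And>s. s \<in> {a<..<b} \<Longrightarrow> W s \<noteq> 0"
  shows "\<exists>l\<in>{-1, 1}. \<forall>s\<in>{a<..<b}. sgn (W s) = l"
proof (rule ccontr)
  assume *: "\<not> ?thesis"
  then obtain x where x: "x \<in> {a<..<b}" "\<not> sgn (W x) = 1" by auto
  from * obtain y where y: "y \<in> {a<..<b}" "\<not> sgn (W y) = -1" by auto
  have "W x < 0" "0 < W y" using x y assms(2)[OF x(1)] assms(2)[OF y(1)]
    by (auto simp: sgn_if split: if_splits)
  moreover have "connected (W ` {a<..<b})"
    by (intro connected_continuous_image assms(1)) simp
  ultimately have "0 \<in> W ` {a<..<b}"
    using connected_contains_Icc[of "W ` {a<..<b}" "W x" "W y"] x y by auto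
  then show False using assms(2) by auto
qed

lemma changes_sign_at_iff:
  assumes "\<forall>\<^sub>F s in at_left t. sgn (f s) = l" "\<forall>\<^sub>F s in at_right t. sgn (f s) = r"
    and "l \<in> {-1, 1}" "r \<in> {-1, 1}"
  shows "changes_sign_at f t \<longleftrightarrow> r = - l"
proof -
  have *: "((\<forall>\<^sub>F s in F. f s < 0) \<longleftrightarrow> x = -1) \<and> ((\<forall>\<^sub>F s in F. 0 < f s) \<longleftrightarrow> x = 1)"
    if ev: "\<forall>\<^sub>F s in F. sgn (f s) = x" and "F \<noteq> bot" and "x \<in> {-1, 1}" for F x
  proof (intro conjI iffI)
    assume "\<forall>\<^sub>F s in F. f s < 0"
    with ev have "\<forall>\<^sub>F s in F. x = -1" by eventually_elim simp
    then show "x = -1" using \<open>F \<noteq> bot\<close> by (simp add: eventually_const)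
  next
    assume "\<forall>\<^sub>F s in F. 0 < f s"
    with ev have "\<forall>\<^sub>F s in F. x = 1" by eventually_elim simp
    then show "x = 1" using \<open>F \<noteq> bot\<close> by (simp add: eventually_const)
  next
    assume "x = -1" with ev show "\<forall>\<^sub>F s in F. f s < 0"
      by (auto elim!: eventually_mono simp: sgn_if split: if_splits)
  next
    assume "x = 1" with ev show "\<forall>\<^sub>F s in F. 0 < f s"
      by (auto elim!: eventually_mono simp: sgn_if split: if_splits)
  qed
  show ?thesis
    unfolding changes_sign_at_def
    using *[OF assms(1) _ assms(3)] *[OF assms(2) _ assms(4)] assms(3,4) by auto
qed

subsection \<open>Closed curves with a continuous tangent line\<close>

text \<open>
  The factor \<open>W\<close> is a signed speed: \<open>\<Psi>\<close> is the angle of the tangent line and stays continuous where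
  the tangent vector reverses.
\<close>

locale closed_front =
  fixes \<beta> :: "real \<Rightarrow> complex" and W \<Psi> :: "real \<Rightarrow> real" and p :: real
  assumes period: "0 < p"
    and deriv: "\<And>t. (\<beta> has_vector_derivative of_real (W t) * cis (\<Psi> t)) (at t)"
    and W_cont: "continuous_on UNIV W" and W_periodic: "\<And>t. W (t + p) = W t"
    and \<Psi>_cont: "continuous_on UNIV \<Psi>"
    and finite_zeros: "finite {t \<in> {0..<p}. W t = 0}"
begin

lemma velocity_eq: "velocity \<beta> t = of_real (W t) * cis (\<Psi> t)"
  unfolding velocity_def by (rule vector_derivative_at[OF deriv])

lemma unit_tangent_eq: "unit_tangent \<beta> t = of_real (sgn (W t)) * cis (\<Psi> t)"
  by (simp add: unit_tangent_def velocity_eq sgn_mult sgn_of_real)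

lemma regular_at_iff: "regular_at \<beta> t \<longleftrightarrow> W t \<noteq> 0"
  by (simp add: regular_at_def velocity_eq)

text \<open>Every zero is a zero of the base period shifted by a multiple of \<open>p\<close>, and
  \<open>0 \<le> t + n * p < p\<close> with \<open>a \<le> t \<le> b\<close> confines
  \<open>n\<close> to the finite range \<open>?N\<close>.\<close>

lemma finite_zeros_Icc: "finite {t \<in> {a..b}. W t = 0}"
proof (rule finite_subset)
  let ?Z = "{t \<in> {0..<p}. W t = 0}" and ?N = "{\<lfloor>- b / p\<rfloor>..\<lceil>(p - a) / p\<rceil>}"
  show "finite ((\<lambda>(z, n). z - of_int n * p) ` (?Z \<times> ?N))" using finite_zeros by simp
  show "{t \<in> {a..b}. W t = 0} \<subseteq> (\<lambda>(z, n). z - of_int n * p) ` (?Z \<times> ?N)"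
  proof
    fix t assume t: "t \<in> {t \<in> {a..b}. W t = 0}"
    obtain n where n: "t + of_int n * p \<in> {0..<p}" by (rule period_representative[OF period])
    have "- b / p \<le> of_int n" "of_int n \<le> (p - a) / p"
      using n t period by (auto simp: field_simps)
    then have "n \<in> ?N" by (simp add: floor_le_iff le_ceiling_iff)
    moreover have "t + of_int n * p \<in> ?Z"
      using n t periodic_int_shift[of W p t n, OF W_periodic] by simp
    ultimately show "t \<in> (\<lambda>(z, n). z - of_int n * p) ` (?Z \<times> ?N)"
      by (intro image_eqI[where x = "(t + of_int n * p, n)"]) auto
  qed
qed

lemma isolated_zeros: "\<forall>\<^sub>F s in at t. W s \<noteq> 0"
proof -
  have "\<not> t islimpt {s \<in> {t - 1..t + 1}. W s = 0}"
    by (rule islimpt_finite[OF finite_zeros_Icc])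
  then have "\<forall>\<^sub>F s in at t. s \<notin> {s \<in> {t - 1..t + 1}. W s = 0}"
    by (simp add: islimpt_iff_eventually)
  moreover have "\<forall>\<^sub>F s in at t. s \<in> {t - 1<..<t + 1}"
    by (rule eventually_at_in_open') auto
  ultimately show ?thesis by eventually_elim auto
qed

lemma one_sided_signs:
  obtains l r where "l \<in> {-1, 1}" "r \<in> {-1, 1}"
    "\<forall>\<^sub>F s in at_left t. sgn (W s) = l" "\<forall>\<^sub>F s in at_right t. sgn (W s) = r"
proof -
  obtain d where d: "d > 0" "\<And>s. s \<noteq> t \<Longrightarrow> dist s t < d \<Longrightarrow> W s \<noteq> 0"
    using isolated_zeros[of t] by (auto simp: eventually_at)
  have "\<exists>l\<in>{-1, 1}. \<forall>s\<in>{t - d<..<t}. sgn (W s) = l" "\<exists>r\<in>{-1, 1}. \<forall>s\<in>{t<..<t + d}. sgn (W s) = r"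
    by (intro continuous_sign_constant continuous_on_subset[OF W_cont];
        use d in \<open>auto simp: dist_real_def\<close>)+
  then obtain l r where "l \<in> {-1, 1}" "r \<in> {-1, 1}" "\<forall>s\<in>{t - d<..<t}. sgn (W s) = l"
    "\<forall>s\<in>{t<..<t + d}. sgn (W s) = r" by blast
  moreover have "\<forall>\<^sub>F s in at_left t. s \<in> {t - d<..<t}" "\<forall>\<^sub>F s in at_right t. s \<in> {t<..<t + d}"
    using d(1) by (intro eventually_at_left_real eventually_at_right_real; simp)+
  ultimately show ?thesis
    by (intro that[of l r]) (blast intro: eventually_mono)+
qed

lemma sgn_locally_constant:
  assumes "W t \<noteq> 0"
  shows "\<forall>\<^sub>F s in at t. sgn (W s) = sgn (W t)"
proof -
  have lim: "(W \<longlongrightarrow> W t) (at t)"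
    using W_cont by (simp add: continuous_on_eq_continuous_at isCont_def)
  show ?thesis
  proof (cases "W t > 0")
    case True
    from order_tendstoD(1)[OF lim this] True show ?thesis by (auto elim!: eventually_mono)
  next
    case False
    then have "W t < 0" using assms by simp
    from order_tendstoD(2)[OF lim this] this show ?thesis by (auto elim!: eventually_mono)
  qed
qed

text \<open>The unit tangent is the sign of \<open>W\<close> times \<open>cis \<Psi>\<close>, and
  \<open>\<Psi>\<close> is continuous, so its one-sided limits are opposite exactly when the
  one-sided signs of \<open>W\<close> are. Opposite signs also force \<open>W t = 0\<close>, since
  near a nonzero value the sign is constant.\<close>

lemma cusp_at_iff: "cusp_at \<beta> t \<longleftrightarrow> changes_sign_at W t"
proof -
  obtain l r where lr: "l \<in> {-1, 1}" "r \<in> {-1, 1}"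
    and evl: "\<forall>\<^sub>F s in at_left t. sgn (W s) = l" and evr: "\<forall>\<^sub>F s in at_right t. sgn (W s) = r"
    by (rule one_sided_signs)
  have "isCont \<Psi> t" using \<Psi>_cont by (simp add: continuous_on_eq_continuous_at)
  then have "((\<lambda>s. of_real x * cis (\<Psi> s)) \<longlongrightarrow> of_real x * cis (\<Psi> t)) (at t)" for x
    unfolding isCont_def by (intro tendsto_intros isCont_tendsto_compose[of _ cis]
        continuous_on_interior[OF continuous_on_cis[OF continuous_on_id]]) auto
  then have lim: "((\<lambda>s. of_real x * cis (\<Psi> s)) \<longlongrightarrow> of_real x * cis (\<Psi> t)) (at_left t)"
    "((\<lambda>s. of_real x * cis (\<Psi> s)) \<longlongrightarrow> of_real x * cis (\<Psi> t)) (at_right t)" for x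
    by (simp_all add: filterlim_at_split)
  have Tl: "(unit_tangent \<beta> \<longlongrightarrow> of_real l * cis (\<Psi> t)) (at_left t)"
    by (rule Lim_transform_eventually[OF lim(1)])
       (use evl in \<open>auto elim!: eventually_mono simp: unit_tangent_eq\<close>)
  have Tr: "(unit_tangent \<beta> \<longlongrightarrow> of_real r * cis (\<Psi> t)) (at_right t)"
    by (rule Lim_transform_eventually[OF lim(2)])
       (use evr in \<open>auto elim!: eventually_mono simp: unit_tangent_eq\<close>)
  show ?thesis
    unfolding changes_sign_at_iff[OF evl evr lr]
  proof
    assume "cusp_at \<beta> t"
    then obtain u where "(unit_tangent \<beta> \<longlongrightarrow> u) (at_left t)" "(unit_tangent \<beta> \<longlongrightarrow> - u) (at_right t)"
      by (auto simp: cusp_at_def)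
    then have "u = of_real l * cis (\<Psi> t)" "- u = of_real r * cis (\<Psi> t)"
      using Tl Tr tendsto_unique trivial_limit_at_left_real trivial_limit_at_right_real by metis+
    then have "of_real (- l) * cis (\<Psi> t) = of_real r * cis (\<Psi> t)" by simp
    then show "r = - l" by (simp flip: of_real_minus)
  next
    assume r: "r = - l"
    have "W t = 0"
    proof (rule ccontr)
      assume nz: "W t \<noteq> 0"
      have ev: "\<forall>\<^sub>F s in at_left t. sgn (W s) = sgn (W t)" "\<forall>\<^sub>F s in at_right t. sgn (W s) = sgn (W t)"
        using sgn_locally_constant[OF nz] by (simp_all add: eventually_at_split)
      have "\<forall>\<^sub>F s in at_left t. l = sgn (W t)"
        using ev(1) evl by eventually_elim simp
      moreover have "\<forall>\<^sub>F s in at_right t. r = sgn (W t)"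
        using ev(2) evr by eventually_elim simp
      ultimately have "l = sgn (W t)" "r = sgn (W t)" by (simp_all add: eventually_const)
      with r lr show False by auto
    qed
    then show "cusp_at \<beta> t"
      unfolding cusp_at_def regular_at_iff using Tl Tr r lr
      by (intro conjI exI[of _ "of_real l * cis (\<Psi> t)"]) (auto simp: norm_mult)
  qed
qed

lemma cusp_at_periodic: "cusp_at \<beta> (t + p) \<longleftrightarrow> cusp_at \<beta> t"
proof -
  have "at_left t = filtermap (\<lambda>x. x - p) (at_left (t + p))"
    "at_right t = filtermap (\<lambda>x. x - p) (at_right (t + p))"
    by (simp_all add: filtermap_at_left_shift filtermap_at_right_shift)
  moreover have "W (s - p) = W s" for s using W_periodic[of "s - p"] by simp
  ultimately show ?thesis
    by (simp add: cusp_at_iff changes_sign_at_def eventually_filtermap)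
qed

text \<open>The inequalities are weak because \<open>W\<close> may vanish without changing sign:
  such a singular point is no cusp and may lie inside an arc.\<close>

lemma weak_sign_without_cusps:
  assumes "\<And>s. s \<in> {a<..<b} \<Longrightarrow> \<not> cusp_at \<beta> s"
  shows "(\<forall>s\<in>{a<..<b}. 0 \<le> W s) \<or> (\<forall>s\<in>{a<..<b}. W s \<le> 0)"
proof -
  \<comment> \<open>The sign immediately to the right of a point is locally constant away from cusps, even at zeros.\<close>
  define f where "f s \<longleftrightarrow> (\<forall>\<^sub>F x in at_right s. sgn (W x) = 1)" for s
  have loc: "\<forall>\<^sub>F s in at t. f t = f s" if t: "t \<in> {a<..<b}" for t
  proof -
    obtain l r where lr: "l \<in> {-1, 1}" "r \<in> {-1, 1}"
      and evl: "\<forall>\<^sub>F s in at_left t. sgn (W s) = l" and evr: "\<forall>\<^sub>F s in at_right t. sgn (W s) = r"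
      by (rule one_sided_signs)
    have "l = r"
      using assms[OF t] lr unfolding cusp_at_iff changes_sign_at_iff[OF evl evr lr] by auto
    with evl evr have ev: "\<forall>\<^sub>F s in at t. sgn (W s) = r" by (simp add: eventually_at_split)
    have f: "f s \<longleftrightarrow> r = 1" if "\<forall>\<^sub>F x in at_right s. sgn (W x) = r" for s
    proof
      assume "f s"
      then have "\<forall>\<^sub>F x in at_right s. r = 1"
        using that unfolding f_def by eventually_elim simp
      then show "r = 1" by (simp add: eventually_const)
    qed (use that in \<open>simp add: f_def\<close>)
    from ev show ?thesis
    proof eventually_elim
      case (elim s)
      then have "W s \<noteq> 0" using lr by auto
      from sgn_locally_constant[OF this] have "\<forall>\<^sub>F x in at_right s. sgn (W x) = r"
        by (simp add: elim eventually_at_split)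
      then show ?case using f evr by blast
    qed
  qed
  have const: "f s = f t" if "s \<in> {a<..<b}" "t \<in> {a<..<b}" for s t
  proof (rule connected_local_const[OF _ that])
    show "\<forall>t\<in>{a<..<b}. \<forall>\<^sub>F s in at t within {a<..<b}. f t = f s"
    proof
      fix t assume t: "t \<in> {a<..<b}"
      show "\<forall>\<^sub>F s in at t within {a<..<b}. f t = f s"
        unfolding at_within_open[OF t open_greaterThanLessThan] by (rule loc[OF t])
    qed
  qed simp
  have lim: "(W \<longlongrightarrow> W t) (at_right t)" for t
    using W_cont by (simp add: continuous_on_eq_continuous_at isCont_def filterlim_at_split)
  have pos: "0 \<le> W t" if "f t" for t
  proof (rule tendsto_lowerbound[OF lim])
    show "\<forall>\<^sub>F x in at_right t. 0 \<le> W x"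
      using that unfolding f_def by (auto elim!: eventually_mono simp: sgn_if split: if_splits)
  qed simp
  have neg: "W t \<le> 0" if "\<not> f t" for t
  proof (rule tendsto_upperbound[OF lim])
    obtain l r where "r \<in> {-1, 1}" "\<forall>\<^sub>F s in at_right t. sgn (W s) = r"
      by (rule one_sided_signs)
    with that have "\<forall>\<^sub>F s in at_right t. sgn (W s) = -1" by (auto simp: f_def)
    then show "\<forall>\<^sub>F x in at_right t. W x \<le> 0"
      by (auto elim!: eventually_mono simp: sgn_if split: if_splits)
  qed simp
  show ?thesis
    using const pos neg by blast
qed

text \<open>Adding 0 or \<open>pi\<close> to \<open>\<Psi>\<close>, according to the sign of
  \<open>W\<close>, gives one admissible angle. Any other differs from it by multiples of
  \<open>2 * pi\<close> at the regular points, which are dense, hence by a single constant that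
  drops out of the difference of end values.\<close>

lemma angle_change_without_cusps:
  assumes "a < b" and "\<And>s. s \<in> {a<..<b} \<Longrightarrow> \<not> cusp_at \<beta> s"
  shows "angle_change \<beta> a b = \<Psi> b - \<Psi> a"
proof -
  define P where "P \<phi> \<longleftrightarrow> continuous_on {a..b} \<phi> \<and>
        (\<forall>t\<in>{a<..<b}. velocity \<beta> t = of_real (norm (velocity \<beta> t)) * cis (\<phi> t))" for \<phi>
  \<comment> \<open>Where \<open>W\<close> is not positive, the tangent vector points against
    \<open>cis \<Psi>\<close>, which is a half turn.\<close>
  define h where "h = (if \<forall>s\<in>{a<..<b}. 0 \<le> W s then 0 else pi)"
  have n: "norm (velocity \<beta> t) = \<bar>W t\<bar>" for t by (simp add: velocity_eq norm_mult)
  have P0: "P (\<lambda>t. \<Psi> t + h)"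
  proof -
    have "of_real (W t) * cis (\<Psi> t) = of_real \<bar>W t\<bar> * cis (\<Psi> t + h)" if "t \<in> {a<..<b}" for t
    proof (cases "\<forall>s\<in>{a<..<b}. 0 \<le> W s")
      case True
      then show ?thesis using that by (simp add: h_def)
    next
      case False
      then have "W t \<le> 0" using weak_sign_without_cusps[of a b] assms(2) that by blast
      moreover have "h = pi" unfolding h_def using False by (rule if_not_P)
      ultimately show ?thesis by (simp flip: cis_mult)
    qed
    moreover have "continuous_on {a..b} (\<lambda>t. \<Psi> t + h)"
      by (intro continuous_intros continuous_on_subset[OF \<Psi>_cont]) simp
    ultimately show ?thesis by (simp add: P_def velocity_eq norm_mult)
  qed
  have uniq: "\<phi> b - \<phi> a = \<Psi> b - \<Psi> a" if P: "P \<phi>" for \<phi>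
  proof -
    define D where "D t = \<phi> t - (\<Psi> t + h)" for t
    have contD: "continuous_on {a..b} D"
      unfolding D_def using P P0 by (intro continuous_on_diff) (auto simp: P_def)
    \<comment> \<open>Only at these regular points is the angle prescribed. Their closure contains
      the singular points and both endpoints, where continuity takes over.\<close>
    let ?S = "{a<..<b} - {t \<in> {a..b}. W t = 0}"
    have clS: "closure ?S = {a..b}"
    proof (rule antisym)
      show "closure ?S \<subseteq> {a..b}" by (rule closure_minimal) auto
      show "{a..b} \<subseteq> closure ?S"
      proof
        fix t assume t: "t \<in> {a..b}"
        have "t islimpt {t<..<b} \<or> t islimpt {a<..<t}"
          using t assms(1) islimpt_greaterThanLessThan1[of t b] islimpt_greaterThanLessThan2[of a t]
          by (cases "t < b") auto
        then have "t islimpt ({t \<in> {a..b}. W t = 0} \<union> ?S)"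
          using t by (elim disjE; elim islimpt_subset) auto
        then have "t islimpt ?S"
          by (rule islimpt_Un_finite[OF finite_zeros_Icc, THEN iffD1])
        then show "t \<in> closure ?S"
          by (simp add: closure_def)
      qed
    qed
    have one: "cis (D t) = 1" if "t \<in> {a..b}" for t
    proof (rule continuous_constant_on_closure[where f = "\<lambda>t. cis (D t)" and S = ?S])
      show "continuous_on (closure ?S) (\<lambda>t. cis (D t))"
        unfolding clS by (intro continuous_on_cis contD)
      show "t \<in> closure ?S" using that clS by simp
      fix s assume s: "s \<in> ?S"
      then have "velocity \<beta> s = of_real \<bar>W s\<bar> * cis (\<phi> s)"
        "velocity \<beta> s = of_real \<bar>W s\<bar> * cis (\<Psi> s + h)"
        using P P0 unfolding P_def n by blast+
      then have "cis (\<phi> s) = cis (\<Psi> s + h)" using s by simp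
      then show "cis (D s) = 1" by (simp add: D_def flip: cis_divide)
    qed
    \<comment> \<open>A continuous function whose distinct values are at least \<open>2 * pi\<close>
      apart is constant on an interval.\<close>
    have "D constant_on {a..b}"
    proof (rule continuous_discrete_range_constant[OF _ contD])
      fix x assume x: "x \<in> {a..b}"
      have "2 * pi \<le> norm (D y - D x)" if y: "y \<in> {a..b}" "D y \<noteq> D x" for y
      proof -
        obtain i j :: int where ij: "D x = 2 * pi * of_int i" "D y = 2 * pi * of_int j"
          using one[OF x] one[OF y(1)] unfolding cis_eq_1_iff by blast
        then have "norm (D y - D x) = 2 * pi * \<bar>of_int (j - i)\<bar>"
          by (simp add: abs_mult flip: right_diff_distrib)
        moreover have "1 \<le> \<bar>real_of_int (j - i)\<bar>" using ij y(2) by auto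
        ultimately show ?thesis using mult_left_mono[of 1 "\<bar>real_of_int (j - i)\<bar>" "2 * pi"] by simp
      qed
      then show "\<exists>e>0. \<forall>y. y \<in> {a..b} \<and> D y \<noteq> D x \<longrightarrow> e \<le> norm (D y - D x)"
        by (intro exI[of _ "2 * pi"]) auto
    qed simp
    then have "D b = D a" using assms(1) by (auto simp: constant_on_def)
    then show ?thesis by (simp add: D_def)
  qed
  have "(THE d. \<exists>\<phi>. P \<phi> \<and> d = \<phi> b - \<phi> a) = \<Psi> b - \<Psi> a"
    by (rule the_equality) (use P0 uniq in force)+
  then show ?thesis by (simp add: angle_change_def P_def conj_assoc)
qed

lemma finite_cusps: "finite (cusps \<beta> p)"
  by (rule finite_subset[OF _ finite_zeros]) (auto simp: cusps_def cusp_at_def regular_at_iff)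

text \<open>By periodicity, a period without cusps means no cusps at all, and then \<open>W\<close>
  could not take both signs on an interval.\<close>

lemma cusps_nonempty:
  assumes "W x < 0" "0 < W y"
  shows "cusps \<beta> p \<noteq> {}"
proof
  assume empty: "cusps \<beta> p = {}"
  have no: "\<not> cusp_at \<beta> t" for t
  proof -
    obtain n where n: "t + of_int n * p \<in> {0..<p}" by (rule period_representative[OF period])
    have "\<not> cusp_at \<beta> (t + of_int n * p)" using n empty by (auto simp: cusps_def)
    then show ?thesis using periodic_int_shift[of "cusp_at \<beta>" p t n, OF cusp_at_periodic] by simp
  qed
  \<comment> \<open>The margin of 1 puts both points inside an open interval.\<close>
  have "x \<in> {min x y - 1<..<max x y + 1}" "y \<in> {min x y - 1<..<max x y + 1}" by auto
  then show False
    using weak_sign_without_cusps[OF no, of "min x y - 1" "max x y + 1"] assms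
    by (metis linorder_not_less)
qed

text \<open>The arcs run between consecutive cusps, so their angle changes telescope to the change
  \<open>- 2 * pi\<close> of \<open>\<Psi>\<close> over a period, to which the convention adds
  \<open>pi\<close> per cusp. The two signs of \<open>W\<close> secure at least one cusp, without
  which there would be nothing to telescope.\<close>

lemma rotation_index_eq:
  assumes "\<And>t. \<Psi> (t + p) = \<Psi> t - 2 * pi" and "W x < 0" "0 < W y"
  shows "rotation_index \<beta> p = (real (card (cusps \<beta> p)) - 2) / 2"
proof -
  let ?C = "{t. cusp_at \<beta> t}"
  have cusps: "cusps \<beta> p = {t \<in> {0..<p}. t \<in> ?C}" by (simp add: cusps_def)
  have next_cusp: "next_cusp \<beta> = (\<lambda>t. Inf {s. t < s \<and> s \<in> ?C})"
    by (simp add: next_cusp_def fun_eq_iff)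
  have F: "\<Psi> (t + p) = \<Psi> t + (- 2 * pi)" for t using assms(1) by simp
  note nxt = sum_next_periodic[of p ?C \<Psi> "- 2 * pi", OF period _ _ _ F,
      folded cusps next_cusp, unfolded mem_Collect_eq, OF cusp_at_periodic finite_cusps
      cusps_nonempty[OF assms(2,3)]]
  have "angle_change \<beta> t (next_cusp \<beta> t) = \<Psi> (next_cusp \<beta> t) - \<Psi> t" if "t \<in> cusps \<beta> p" for t
  proof (rule angle_change_without_cusps)
    have t: "t < next_cusp \<beta> t \<and> (\<forall>s\<in>?C. t < s \<longrightarrow> next_cusp \<beta> t \<le> s)"
      using nxt(1)[of t] that by (simp add: cusps_def next_cusp_def)
    then show "t < next_cusp \<beta> t" by simp
    show "\<not> cusp_at \<beta> s" if "s \<in> {t<..<next_cusp \<beta> t}" for s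
      using t that by force
  qed
  then have "(\<Sum>t\<in>cusps \<beta> p. angle_change \<beta> t (next_cusp \<beta> t)) = - 2 * pi"
    using nxt(2) by (simp add: cusps_def next_cusp_def)
  then show ?thesis
    by (simp add: rotation_index_def field_simps)
qed

end

section \<open>Auxiliary facts on periodic functions and sign changes\<close>

lemma velocity_periodic:
  assumes "\<And>t. f (t + p) = f t" "(f has_vector_derivative D) (at (t + p))"
  shows "velocity f (t + p) = velocity f t"
proof -
  have "((\<lambda>x. x + p) has_vector_derivative 1) (at t)"
    by (auto intro!: derivative_eq_intros)
  from vector_diff_chain_at[OF this assms(2)]
  have "(f has_vector_derivative D) (at t)" using assms(1) by (simp add: o_def)
  then show ?thesis
    using assms(2) by (simp add: velocity_def vector_derivative_at)
qed

text \<open>A nondecreasing function with equal end values is constant in between. Applied to the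
  radius of curvature and to its negative, this shows that \<open>W\<close> takes both
  signs.\<close>

lemma periodic_monotone_deriv_zero:
  fixes q W :: "real \<Rightarrow> real"
  assumes "\<And>t. (q has_real_derivative W t) (at t)" "q p = q 0"
    and "\<And>t. 0 \<le> W t" "t \<in> {0<..<p}"
  shows "W t = 0"
proof -
  have mono: "q x \<le> q y" if "x \<le> y" for x y
    by (rule DERIV_nonneg_imp_nondecreasing[OF that]) (use assms in blast)
  have "q x = q 0" if "x \<in> {0<..<p}" for x
    using mono[of 0 x] mono[of x p] that assms(2) by auto
  then have "((\<lambda>x. q 0) has_real_derivative W t) (at t)"
    using has_field_derivative_transform_within_open[OF assms(1)[of t] open_greaterThanLessThan assms(4)]
    by auto
  then show ?thesis using DERIV_const DERIV_unique by blast
qed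

lemma changes_sign_at_cong_sgn:
  assumes "\<And>s. sgn (g s) = e * sgn (f s)" "e = 1 \<or> e = -1" "changes_sign_at f t"
  shows "changes_sign_at g t"
  using assms(2)
proof
  assume "e = 1"
  then have "g s < 0 \<longleftrightarrow> f s < 0" "0 < g s \<longleftrightarrow> 0 < f s" for s
    using assms(1)[of s] by (auto simp: sgn_if split: if_splits)
  with assms(3) show ?thesis by (simp add: changes_sign_at_def)
next
  assume "e = -1"
  then have "g s < 0 \<longleftrightarrow> 0 < f s" "0 < g s \<longleftrightarrow> f s < 0" for s
    using assms(1)[of s] by (auto simp: sgn_if split: if_splits)
  with assms(3) show ?thesis by (auto simp: changes_sign_at_def)
qed

text \<open>Reflection swaps the two sides of a point, and either order of the signs counts as a
  change.\<close>

lemma changes_sign_at_reflect: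
  assumes "changes_sign_at f (- t)"
  shows "changes_sign_at (\<lambda>s. f (- s)) t"
proof -
  have "(\<forall>\<^sub>F s in at_left t. P (f (- s))) \<longleftrightarrow> (\<forall>\<^sub>F s in at_right (- t). P (f s))"
    "(\<forall>\<^sub>F s in at_left (- t). P (f s)) \<longleftrightarrow> (\<forall>\<^sub>F s in at_right t. P (f (- s)))" for P
    using eventually_at_left_to_right[of "\<lambda>s. P (f (- s))" t]
      eventually_at_left_to_right[of "\<lambda>s. P (f s)" "- t"] by simp_all
  from this[of "\<lambda>y. y < 0"] this[of "\<lambda>y. 0 < y"] assms show ?thesis
    unfolding changes_sign_at_def by blast
qed

subsection \<open>The tangent angle of an oval\<close>

lemma plane_ovalD:
  assumes "plane_oval \<gamma> p"
  shows "0 < p" "\<And>t. \<gamma> (t + p) = \<gamma> t" "inj_on \<gamma> {0..<p}" "smooth_curve \<gamma>"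
    "\<And>t. regular_at \<gamma> t" "strictly_convex_curve \<gamma>" "\<And>t. curvature \<gamma> t \<noteq> 0"
  using assms by (auto simp: plane_oval_def)

text \<open>Shifting both parameters into the base period shows that they differ by a multiple of
  \<open>p\<close>, which must be 0 when they are less than \<open>p\<close> apart. This covers
  parameters outside \<open>{0..<p}\<close>, which occur when the traversal is reversed.\<close>

lemma plane_oval_inj:
  assumes "plane_oval \<gamma> p" "\<gamma> a = \<gamma> b" "\<bar>a - b\<bar> < p"
  shows "a = b"
proof -
  note o = plane_ovalD[OF assms(1)]
  obtain n where n: "a + of_int n * p \<in> {0..<p}" by (rule period_representative[OF o(1)])
  obtain m where m: "b + of_int m * p \<in> {0..<p}" by (rule period_representative[OF o(1)])
  have "\<gamma> (a + of_int n * p) = \<gamma> (b + of_int m * p)"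
    using assms(2) by (simp add: periodic_int_shift[of \<gamma>, OF o(2)])
  then have eq: "a + of_int n * p = b + of_int m * p" by (rule inj_onD[OF o(3) _ n m])
  then have "of_int (m - n) * p = a - b" by (simp add: algebra_simps)
  then have "\<bar>of_int (m - n)\<bar> * p = \<bar>a - b\<bar>" using o(1) by (metis abs_mult abs_of_pos)
  then have "\<bar>of_int (m - n)\<bar> * p < 1 * p" using assms(3) by simp
  then have "\<bar>real_of_int (m - n)\<bar> < 1" using o(1) by (simp only: mult_less_cancel_right)
  then have "m = n" by linarith
  then show ?thesis using eq by simp
qed

lemma plane_oval_periodic:
  assumes "plane_oval \<gamma> p"
  shows "velocity \<gamma> (t + p) = velocity \<gamma> t" "unit_tangent \<gamma> (t + p) = unit_tangent \<gamma> t"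
    "curvature \<gamma> (t + p) = curvature \<gamma> t"
    "velocity (curvature \<gamma>) (t + p) = velocity (curvature \<gamma>) t"
proof -
  note o = plane_ovalD[OF assms]
  have nz: "velocity \<gamma> t \<noteq> 0" for t using o(5) by (simp add: regular_at_def)
  have dc: "(\<gamma> has_vector_derivative velocity \<gamma> t) (at t)" for t
    using smooth_curve_has_vector_derivative[OF o(4), of 0] by simp
  have dv: "(velocity \<gamma> has_vector_derivative (velocity ^^ 2) \<gamma> t) (at t)" for t
    using smooth_curve_has_vector_derivative[OF o(4), of 1] by (simp add: numeral_2_eq_2)
  have v: "velocity \<gamma> (t + p) = velocity \<gamma> t" for t
    by (rule velocity_periodic[of \<gamma> p, OF o(2) dc])
  then have T: "unit_tangent \<gamma> (t + p) = unit_tangent \<gamma> t" for t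
    by (simp add: unit_tangent_def)
  have k: "curvature \<gamma> (t + p) = curvature \<gamma> t" for t
    using velocity_periodic[of "unit_tangent \<gamma>" p, OF T curvature_formula(1)[OF dv refl nz], of t] v T
    by (simp add: curvature_def arclength_derivative_def left_normal_def)
  show "velocity \<gamma> (t + p) = velocity \<gamma> t" "unit_tangent \<gamma> (t + p) = unit_tangent \<gamma> t"
    "curvature \<gamma> (t + p) = curvature \<gamma> t" using v T k by auto
  show "velocity (curvature \<gamma>) (t + p) = velocity (curvature \<gamma>) t"
    by (rule velocity_periodic[of "curvature \<gamma>" p, OF k curvature_continuously_differentiable(1)
          [OF o(4,5), unfolded has_real_derivative_iff_has_vector_derivative]])
qed

text \<open>The sign \<open>e\<close> of the curvature tells the direction of turning. That the
  tangent makes exactly one turn is derived from strict convexity together with injectivity on a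
  period.\<close>

lemma plane_oval_angle_function:
  assumes "plane_oval \<gamma> p"
  obtains \<theta> :: "real \<Rightarrow> real" and e :: real
  where "e = 1 \<or> e = -1" "\<And>t. unit_tangent \<gamma> t = cis (\<theta> t)" "continuous_on UNIV \<theta>"
    "strict_mono (\<lambda>t. e * \<theta> t)" "\<And>t. \<theta> (t + p) = \<theta> t + e * (2 * pi)"
proof -
  note o = plane_ovalD[OF assms]
  note per = plane_oval_periodic[OF assms]
  let ?k = "curvature \<gamma>" and ?v = "velocity \<gamma>"
  have nz: "?v t \<noteq> 0" for t using o(5) by (simp add: regular_at_def)
  have dc: "(\<gamma> has_vector_derivative ?v t) (at t)" for t
    using smooth_curve_has_vector_derivative[OF o(4), of 0] by simp
  have dv: "(velocity \<gamma> has_vector_derivative (velocity ^^ 2) \<gamma> t) (at t)" for t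
    using smooth_curve_has_vector_derivative[OF o(4), of 1] by (simp add: numeral_2_eq_2)
  obtain \<theta> where T: "\<And>t. unit_tangent \<gamma> t = cis (\<theta> t)"
    and d\<theta>: "\<And>t. (\<theta> has_real_derivative ?k t * norm (?v t)) (at t)"
    using regular_curve_has_angle_function[OF o(4,5)] by blast
  have cont\<theta>: "isCont \<theta> t" for t by (rule DERIV_isCont[OF d\<theta>])
  define e where "e = sgn (?k 0)"
  have e: "e = 1 \<or> e = -1" using o(7)[of 0] by (auto simp: e_def sgn_if)
  \<comment> \<open>The interval is chosen to contain both 0 and \<open>t\<close>.\<close>
  have sk: "sgn (?k t) = e" for t
  proof -
    have "continuous_on {-\<bar>t\<bar> - 1<..<\<bar>t\<bar> + 1} ?k"
      by (meson curvature_continuously_differentiable(1)[OF o(4,5)] DERIV_isCont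
          continuous_at_imp_continuous_on)
    from continuous_sign_constant[OF this o(7)]
    obtain l where l: "\<And>s. s \<in> {-\<bar>t\<bar> - 1<..<\<bar>t\<bar> + 1} \<Longrightarrow> sgn (?k s) = l" by blast
    have "t \<in> {-\<bar>t\<bar> - 1<..<\<bar>t\<bar> + 1}" "0 \<in> {-\<bar>t\<bar> - 1<..<\<bar>t\<bar> + 1}"
      by (cases "0 \<le> t"; simp)+
    then show ?thesis using l unfolding e_def by metis
  qed
  have mono: "strict_mono (\<lambda>t. e * \<theta> t)"
  proof (rule strict_monoI)
    fix x y :: real assume "x < y"
    then show "e * \<theta> x < e * \<theta> y"
    proof (rule DERIV_pos_imp_increasing)
      fix t
      have "((\<lambda>t. e * \<theta> t) has_real_derivative e * (?k t * norm (?v t))) (at t)"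
        by (rule DERIV_cmult[OF d\<theta>])
      moreover have eq: "e * (?k t * norm (?v t)) = \<bar>?k t\<bar> * norm (?v t)"
        by (simp add: sk[of t, symmetric] abs_sgn mult_ac)
      have "0 < e * (?k t * norm (?v t))" unfolding eq using nz[of t] o(7)[of t] by simp
      ultimately show "\<exists>y. ((\<lambda>t. e * \<theta> t) has_real_derivative y) (at t) \<and> 0 < y" by blast
    qed
  qed
  have vel: "(\<gamma> has_vector_derivative of_real (norm (?v t)) * cis (\<theta> t)) (at t)" for t
  proof -
    have "of_real (norm (?v t)) * cis (\<theta> t) = ?v t"
      using nz by (simp add: T[symmetric] unit_tangent_def sgn_div_norm flip: scaleR_conv_of_real)
    then show ?thesis using dc[of t] by simp
  qed
  \<comment> \<open>Strict convexity leaves open on which side of the tangent line the curve lies. A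
    nearby point \<open>r\<close> decides it locally, and convexity carries the decision over to
    every other point.\<close>
  have side: "e * ((\<gamma> s - \<gamma> t) \<bullet> left_normal \<gamma> t) > 0" if "\<gamma> s \<noteq> \<gamma> t" for s t
  proof -
    have "isCont (\<lambda>t. norm (?v t)) t"
      using has_vector_derivative_continuous[OF dv] by (intro continuous_intros) auto
    from tangent_line_side[of \<gamma> "\<lambda>t. norm (?v t)" \<theta>, OF vel this cont\<theta> _ e mono] nz
    have "\<forall>\<^sub>F s in at_right t. e * ((\<gamma> s - \<gamma> t) \<bullet> left_normal \<gamma> t) > 0" by simp
    from eventually_happens'[OF _ this]
    obtain r where r: "e * ((\<gamma> r - \<gamma> t) \<bullet> left_normal \<gamma> t) > 0" by auto
    then have "\<gamma> r \<noteq> \<gamma> t" by auto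
    then have "(\<forall>x\<in>{r, s}. (\<gamma> x - \<gamma> t) \<bullet> left_normal \<gamma> t > 0) \<or>
        (\<forall>x\<in>{r, s}. (\<gamma> x - \<gamma> t) \<bullet> left_normal \<gamma> t < 0)"
      using o(6) that unfolding strictly_convex_curve_def by blast
    then show ?thesis using r e by auto
  qed
  \<comment> \<open>The turning over one period does not depend on the starting point, and it is a
    multiple of \<open>2 * pi\<close> because the unit tangent is periodic.\<close>
  define D where "D = \<theta> (0 + p) - \<theta> 0"
  have D: "\<theta> (t + p) - \<theta> t = D" for t
    unfolding D_def
  proof (rule DERIV_isconst_all[of "\<lambda>t. \<theta> (t + p) - \<theta> t"], rule allI)
    fix t
    have "((\<lambda>t. \<theta> (t + p)) has_real_derivative ?k (t + p) * norm (?v (t + p))) (at t)"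
      using d\<theta>[of "t + p"] by (simp add: DERIV_shift)
    from DERIV_diff[OF this d\<theta>]
    show "((\<lambda>t. \<theta> (t + p) - \<theta> t) has_real_derivative 0) (at t)" by (simp add: per)
  qed
  have "cis D = 1" using T[of "0 + p"] T[of 0] per(2)[of 0] by (simp add: D_def flip: cis_divide)
  then obtain n :: int where n: "D = 2 * pi * of_int n" by (auto simp: cis_eq_1_iff)
  have "0 < e * D" using strict_monoD[OF mono o(1)] by (simp add: D_def algebra_simps)
  then have "0 < 2 * pi * (e * of_int n)" by (simp add: n mult_ac)
  then have pos: "0 < e * of_int n" by (rule zero_less_mult_pos) simp
  \<comment> \<open>A second turn would give distinct points with equal normals, each strictly on the positive side
    of the tangent line at the other.\<close>
  have "e * of_int n = 1"
  proof (rule ccontr)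
    assume "e * of_int n \<noteq> 1"
    moreover obtain j :: int where j: "e * of_int n = of_int j"
      using e by (metis minus_mult_left mult_1 of_int_minus)
    ultimately have "2 \<le> j" using pos by auto
    then have n2: "2 \<le> e * of_int n" by (simp add: j)
    \<comment> \<open>The turning over the period is now at least \<open>4 * pi\<close>, so a first
      full turn is completed at an interior parameter.\<close>
    have "\<exists>s. 0 \<le> s \<and> s \<le> p \<and> e * \<theta> s = e * \<theta> 0 + 2 * pi"
    proof (rule IVT)
      have "e * \<theta> p = e * \<theta> 0 + 2 * pi * (e * of_int n)"
        using D[of 0] n by (simp add: algebra_simps)
      moreover have "2 * pi * 2 \<le> 2 * pi * (e * of_int n)" using n2 by (intro mult_left_mono) auto
      ultimately show "e * \<theta> 0 + 2 * pi \<le> e * \<theta> p" by simp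
    qed (use o(1) cont\<theta> in auto)
    then obtain s where s: "0 \<le> s" "s \<le> p" "e * \<theta> s = e * \<theta> 0 + 2 * pi" by blast
    have "s \<noteq> 0" using s(3) by auto
    moreover have "s \<noteq> p"
    proof
      assume "s = p"
      then have "e * D = 2 * pi" using s(3) by (simp add: D_def algebra_simps)
      then have "2 * pi * (e * of_int n) = 2 * pi * 1" by (simp add: n)
      then show False using n2 by simp
    qed
    ultimately have "\<gamma> s \<noteq> \<gamma> 0" using plane_oval_inj[OF assms, of s 0] s by auto
    have "\<theta> s = \<theta> 0 + 2 * pi \<or> \<theta> s = \<theta> 0 - 2 * pi" using s(3) e by auto
    then have "unit_tangent \<gamma> s = unit_tangent \<gamma> 0"
      by (auto simp: T simp flip: cis_mult cis_divide)
    then have N: "left_normal \<gamma> s = left_normal \<gamma> 0" by (simp add: left_normal_def)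
    have "0 < e * ((\<gamma> s - \<gamma> 0) \<bullet> left_normal \<gamma> 0)" "0 < e * ((\<gamma> 0 - \<gamma> s) \<bullet> left_normal \<gamma> 0)"
      using side[of s 0] side[of 0 s] \<open>\<gamma> s \<noteq> \<gamma> 0\<close> N by auto
    then show False by (simp add: inner_diff_left algebra_simps)
  qed
  then have "of_int n = e" using e by auto
  then have "\<theta> (t + p) = \<theta> t + e * (2 * pi)" for t using D[of t] n by (simp add: algebra_simps)
  with that[OF e T _ mono] cont\<theta> show ?thesis
    by (simp add: continuous_at_imp_continuous_on)
qed

subsection \<open>The evolute\<close>

text \<open>The sign \<open>s\<close> accounts for the two directions of traversal of the evolute.\<close>

lemma bij_betw_vertices:
  assumes "plane_oval \<gamma> p" "s = 1 \<or> s = -1"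
  shows "bij_betw (\<lambda>t. \<gamma> (s * t)) {t \<in> {0..<p}. vertex_at \<gamma> (s * t)} (vertices \<gamma>)"
proof (rule bij_betw_imageI)
  note o = plane_ovalD[OF assms(1)]
  have vp: "vertex_at \<gamma> (t + p) = vertex_at \<gamma> t" for t
    using plane_oval_periodic[OF assms(1), of t] by (simp add: vertex_at_def arclength_derivative_def)
  show "inj_on (\<lambda>t. \<gamma> (s * t)) {t \<in> {0..<p}. vertex_at \<gamma> (s * t)}"
  proof (rule inj_onI)
    fix x y assume xy: "x \<in> {t \<in> {0..<p}. vertex_at \<gamma> (s * t)}" "y \<in> {t \<in> {0..<p}. vertex_at \<gamma> (s * t)}"
      "\<gamma> (s * x) = \<gamma> (s * y)"
    have "\<bar>s * x - s * y\<bar> < p" using xy assms(2) by auto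
    then have "s * x = s * y" using plane_oval_inj[OF assms(1) xy(3)] by blast
    then show "x = y" using assms(2) by auto
  qed
  show "(\<lambda>t. \<gamma> (s * t)) ` {t \<in> {0..<p}. vertex_at \<gamma> (s * t)} = vertices \<gamma>"
  proof (intro equalityI subsetI)
    fix z assume "z \<in> vertices \<gamma>"
    then obtain t where t: "z = \<gamma> t" "vertex_at \<gamma> t" by (auto simp: vertices_def)
    obtain n where n: "s * t + of_int n * p \<in> {0..<p}" by (rule period_representative[OF o(1)])
    \<comment> \<open>Since \<open>s * s = 1\<close>, reflecting the representative gives
      \<open>t\<close> up to a shift by a multiple of \<open>p\<close>.\<close>
    have "s * (s * t + of_int n * p) = t + of_int n * p \<or> s * (s * t + of_int n * p) = t + of_int (- n) * p"
      using assms(2) by (auto simp: algebra_simps)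
    then obtain m where m: "s * (s * t + of_int n * p) = t + of_int m * p" by blast
    have "vertex_at \<gamma> (s * (s * t + of_int n * p))" "\<gamma> (s * (s * t + of_int n * p)) = z"
      unfolding m using t periodic_int_shift[of \<gamma> p t m, OF o(2)]
        periodic_int_shift[of "vertex_at \<gamma>" p t m, OF vp] by auto
    then show "z \<in> (\<lambda>t. \<gamma> (s * t)) ` {t \<in> {0..<p}. vertex_at \<gamma> (s * t)}"
      using n by (intro image_eqI[where x = "s * t + of_int n * p"]) auto
  qed (auto simp: vertices_def)
qed

section \<open>The rotation index of the evolute\<close>

theorem theorem1:
  fixes \<gamma> \<beta> :: "real \<Rightarrow> complex" and p :: real
  assumes "plane_oval \<gamma> p"
    and "finite (vertices \<gamma>)"
    and "standard_evolute \<gamma> \<beta>"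
  shows "rotation_index \<beta> p = (real (card (cusps \<beta> p)) - 2) / 2 \<and>
    ((\<forall>t. vertex_at \<gamma> t \<longrightarrow> changes_sign_at (arclength_derivative \<gamma> (curvature \<gamma>)) t) \<longrightarrow>
      card (cusps \<beta> p) = card (vertices \<gamma>))"
proof -
  note o = plane_ovalD[OF assms(1)]
  note per = plane_oval_periodic[OF assms(1)]
  let ?k = "curvature \<gamma>" and ?v = "velocity \<gamma>"
  have nz: "?v t \<noteq> 0" for t using o(5) by (simp add: regular_at_def)
  obtain s :: real where s: "s = 1 \<or> s = -1" and \<beta>: "\<beta> = (\<lambda>t. evolute \<gamma> (s * t))"
  proof -
    have "\<beta> = (\<lambda>t. evolute \<gamma> (1 * t)) \<or> \<beta> = (\<lambda>t. evolute \<gamma> (-1 * t))"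
      using assms(3) by (auto simp: standard_evolute_def)
    then show ?thesis using that by blast
  qed
  obtain \<theta> :: "real \<Rightarrow> real" and e :: real
    where e: "e = 1 \<or> e = -1" and T: "\<And>t. unit_tangent \<gamma> t = cis (\<theta> t)"
      and cont\<theta>: "continuous_on UNIV \<theta>"
      and mono: "strict_mono (\<lambda>t. e * \<theta> t)" and \<theta>p: "\<And>t. \<theta> (t + p) = \<theta> t + e * (2 * pi)"
    using plane_oval_angle_function[OF assms(1)] by metis
  \<comment> \<open>\<open>w\<close> is the derivative of \<open>1 / k\<close>. The factor
    \<open>s\<close> in \<open>W\<close> comes from the chain rule, and \<open>pi / 2\<close> in
    \<open>\<Psi>\<close> from the evolute moving along the normal of
    \<open>\<gamma>\<close>.\<close>
  define w where "w t = - velocity ?k t / (?k t)\<^sup>2" for t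
  define W where "W t = s * w (s * t)" for t
  define \<Psi> where "\<Psi> t = \<theta> (s * t) + pi / 2" for t
  have wp: "w (t + p) = w t" for t using per by (simp add: w_def)
  have dk: "(?k has_real_derivative velocity ?k t) (at t)" for t
    by (rule curvature_continuously_differentiable(1)[OF o(4,5)])
  have contk: "continuous_on A ?k" for A
    by (meson dk DERIV_isCont continuous_at_imp_continuous_on)
  have contw: "continuous_on UNIV w"
    unfolding w_def using o(7)
    by (intro continuous_intros contk curvature_continuously_differentiable(2)[OF o(4,5)]) auto
  have zero: "W t = 0 \<longleftrightarrow> vertex_at \<gamma> (s * t)" for t
    using s o(7) nz by (auto simp: W_def w_def vertex_at_def arclength_derivative_def)
  \<comment> \<open>Vertices are points, zeros of \<open>W\<close> are parameters. This matching
    turns finiteness of the former into \<open>finite_zeros\<close> and later compares the two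
    counts.\<close>
  have bij: "bij_betw (\<lambda>t. \<gamma> (s * t)) {t \<in> {0..<p}. W t = 0} (vertices \<gamma>)"
    unfolding zero by (rule bij_betw_vertices[OF assms(1) s])
  have lin: "((*) s has_vector_derivative s) (at t)" for t
    by (auto intro!: derivative_eq_intros)
  interpret closed_front \<beta> W \<Psi> p
  proof
    fix t
    have "(evolute \<gamma> has_vector_derivative w (s * t) *\<^sub>R left_normal \<gamma> (s * t)) (at (s * t))"
      unfolding w_def by (rule evolute_has_vector_derivative[OF o(4,5,7)])
    from vector_diff_chain_at[OF lin this]
    show "(\<beta> has_vector_derivative of_real (W t) * cis (\<Psi> t)) (at t)"
      by (simp add: \<beta> o_def W_def \<Psi>_def left_normal_def T scaleR_conv_of_real mult_ac flip: cis_mult)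
    show "W (t + p) = W t"
      using s wp[of t] wp[of "- (t + p)"] by (auto simp: W_def)
    show "continuous_on UNIV W"
      unfolding W_def
      by (intro continuous_intros continuous_on_compose2[OF contw]) auto
    show "continuous_on UNIV \<Psi>"
      unfolding \<Psi>_def
      by (intro continuous_intros continuous_on_compose2[OF cont\<theta>]) auto
    show "finite {t \<in> {0..<p}. W t = 0}"
      using bij_betw_finite[OF bij] assms(2) by simp
  qed (rule o(1))
  have nonvertex: "\<exists>t\<in>{0<..<p}. W t \<noteq> 0"
  proof (rule ccontr)
    assume "\<not> ?thesis"
    then have "{0<..<p} \<subseteq> {t \<in> {0..<p}. W t = 0}" by auto
    then show False using finite_zeros finite_subset infinite_Ioo[OF o(1)] by blast
  qed
  \<comment> \<open>Otherwise \<open>\<Psi>\<close> increases and, just after a regular point,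
    \<open>\<beta>\<close> lies to the left of its tangent line there, against the standard
    orientation.\<close>
  have "s * e = -1"
  proof (rule ccontr)
    assume "s * e \<noteq> -1"
    then have se: "s * e = 1" using s e by auto
    have "strict_mono \<Psi>"
    proof (rule strict_monoI)
      fix x y :: real assume "x < y"
      then show "\<Psi> x < \<Psi> y"
        using strict_monoD[OF mono, of x y] strict_monoD[OF mono, of "- y" "- x"] s e se
        by (auto simp: \<Psi>_def)
    qed
    moreover obtain t where t: "W t \<noteq> 0" using nonvertex by blast
    moreover have "isCont W t" "isCont \<Psi> t"
      using W_cont \<Psi>_cont by (simp_all add: continuous_on_eq_continuous_at)
    ultimately have "\<forall>\<^sub>F x in at_right t. 1 * ((\<beta> x - \<beta> t) \<bullet> left_normal \<beta> t) > 0"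
      by (intro tangent_line_side[of \<beta> W \<Psi> t 1, OF deriv]) auto
    moreover have "\<forall>\<^sub>F x in at_right t. (\<beta> x - \<beta> t) \<bullet> left_normal \<beta> t < 0"
      using assms(3) t
      by (simp add: standard_evolute_def standardly_oriented_def regular_at_iff eventually_at_split)
    ultimately have "\<forall>\<^sub>F x in at_right t. False" by eventually_elim simp
    then show False by simp
  qed
  then have \<Psi>p: "\<Psi> (t + p) = \<Psi> t - 2 * pi" for t
    using s e \<theta>p[of t] \<theta>p[of "- (t + p)"] by (auto simp: \<Psi>_def)
  \<comment> \<open>The signed radius of curvature along \<open>\<beta>\<close> is a periodic
    antiderivative of \<open>W\<close>.\<close>
  define q where "q t = inverse (?k (s * t))" for t
  have dq: "(q has_real_derivative W t) (at t)" for t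
  proof -
    have "((\<lambda>t. ?k (s * t)) has_real_derivative velocity ?k (s * t) * s) (at t)"
      using DERIV_chain2[OF dk DERIV_cmult_Id] by simp
    from DERIV_inverse'[OF this o(7)] show ?thesis
      by (simp add: q_def[abs_def] W_def w_def power2_eq_square divide_inverse mult_ac)
  qed
  have qp: "q p = q 0"
    using s per(3)[of 0] per(3)[of "- p"] by (auto simp: q_def)
  obtain x where x: "W x < 0"
    using periodic_monotone_deriv_zero[OF dq qp] nonvertex by (meson linorder_not_less)
  obtain y where y: "0 < W y"
  proof (rule ccontr)
    assume "\<not> thesis"
    then have "0 \<le> - W t" for t using that[of t] by (cases "0 < W t") auto
    then have "- W t = 0" if "t \<in> {0<..<p}" for t
      by (intro periodic_monotone_deriv_zero[of "\<lambda>t. - q t" "\<lambda>t. - W t" p t])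
         (use that qp in \<open>auto intro!: DERIV_minus dq\<close>)
    then show False using nonvertex by auto
  qed
  have "card (cusps \<beta> p) = card (vertices \<gamma>)"
    if *: "\<forall>t. vertex_at \<gamma> t \<longrightarrow> changes_sign_at (arclength_derivative \<gamma> ?k) t"
  proof -
    \<comment> \<open>A zero of \<open>W\<close> comes from a vertex, where the derivative of the
      curvature changes sign by hypothesis. \<open>W\<close> has the same sign as that derivative at
      \<open>s * t\<close>, up to the constant factor \<open>- s\<close>, so it changes sign as
      well.\<close>
    have "cusp_at \<beta> t \<longleftrightarrow> W t = 0" for t
    proof
      assume "W t = 0"
      then have "changes_sign_at (arclength_derivative \<gamma> ?k) (s * t)" using * zero by blast
      then have ch: "changes_sign_at (\<lambda>t. arclength_derivative \<gamma> ?k (s * t)) t"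
        using s changes_sign_at_reflect by auto
      have sg: "sgn (W t) = - s * sgn (arclength_derivative \<gamma> ?k (s * t))" for t
      proof -
        have "(sgn (?k t))\<^sup>2 = 1" for t using o(7)[of t] by (simp add: sgn_if)
        then show ?thesis
          using s nz by (auto simp: W_def w_def arclength_derivative_def sgn_mult sgn_divide sgn_inverse)
      qed
      have "- s = 1 \<or> - s = -1" using s by auto
      from changes_sign_at_cong_sgn[OF sg this ch] show "cusp_at \<beta> t"
        by (simp add: cusp_at_iff)
    qed (simp add: cusp_at_def regular_at_iff)
    then show ?thesis
      using bij_betw_same_card[OF bij] by (simp add: cusps_def)
  qed
  then show ?thesis
    using rotation_index_eq[OF \<Psi>p x y] by blast
qed

end
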